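(* Let $\Omega \subseteq \mathbb{R}^n$ be convex, open, and bounded, let $u,v\in W^{1,\infty}(\Omega)$ be convex with $u=v$ on $\partial \Omega$ and $u \geq v$ in $\Omega$, and let $\phi\in C^0(\overline \Omega)$ be concave and non-negative. Then $$\int_\Omega\phi\,d \mu_u \leq \int_\Omega\phi\,d \mu_v .$$
   Context: For a convex function $u:\Omega\to\mathbb{R}$ on an open convex set $\Omega\subseteq\mathbb{R}^n$, the subdifferential is $\partial^-u(x):=\{p\in\mathbb{R}^n: p\cdot(y-x)+u(x)\le u(y)\text{ for all }y\in\Omega\}$, $\partial^-u(E):=\bigcup_{x\in E}\partial^-u(x)$, and the Monge-Ampère measure of $u$ is $\mu_u(E):=\mathcal L^n(\partial^-u(E))$ for Borel sets $E\subseteq\Omega$, where $\mathcal L^n$ is Lebesgue measure. Functions in $W^{1,\infty}(\Omega)$ are identified with their continuous extension to $\overline\Omega$. *)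

theory Defs
  imports "HOL-Analysis.Analysis"
begin

primrec C_k :: "nat \<Rightarrow> ('a::euclidean_space \<Rightarrow> real) \<Rightarrow> bool" where
  "C_k 0 f \<longleftrightarrow> continuous_on UNIV f"
| "C_k (Suc k) f \<longleftrightarrow> f differentiable_on UNIV \<and>
     (\<forall>b\<in>Basis. C_k k (\<lambda>x. frechet_derivative f (at x) b))"

text \<open>Elements of \<open>C\<^sub>c\<^sup>\<infinity>(\<Omega>)\<close> are represented by their extension by zero to the whole space.\<close>

definition test_function :: "'a::euclidean_space set \<Rightarrow> ('a \<Rightarrow> real) \<Rightarrow> bool" where
  "test_function \<Omega> \<psi> \<longleftrightarrow> (\<forall>k. C_k k \<psi>) \<and>
     compact (closure {x. \<psi> x \<noteq> 0}) \<and> closure {x. \<psi> x \<noteq> 0} \<subseteq> \<Omega>"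

definition L_infinity :: "'a::euclidean_space set \<Rightarrow> ('a \<Rightarrow> real) \<Rightarrow> bool" where
  "L_infinity \<Omega> g \<longleftrightarrow> g \<in> borel_measurable (lebesgue_on \<Omega>) \<and>
     (\<exists>C. AE x in lebesgue_on \<Omega>. \<bar>g x\<bar> \<le> C)"

definition weak_partial_derivative ::
  "'a::euclidean_space set \<Rightarrow> 'a \<Rightarrow> ('a \<Rightarrow> real) \<Rightarrow> ('a \<Rightarrow> real) \<Rightarrow> bool" where
  "weak_partial_derivative \<Omega> b u g \<longleftrightarrow> (\<forall>\<psi>. test_function \<Omega> \<psi> \<longrightarrow>
     (LINT x|lebesgue_on \<Omega>. u x * frechet_derivative \<psi> (at x) b) =
     - (LINT x|lebesgue_on \<Omega>. g x * \<psi> x))"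

definition W1_infinity :: "'a::euclidean_space set \<Rightarrow> ('a \<Rightarrow> real) \<Rightarrow> bool" where
  "W1_infinity \<Omega> u \<longleftrightarrow> L_infinity \<Omega> u \<and>
     (\<forall>b\<in>Basis. \<exists>g. L_infinity \<Omega> g \<and> weak_partial_derivative \<Omega> b u g)"

definition subdifferential ::
  "'a::euclidean_space set \<Rightarrow> ('a \<Rightarrow> real) \<Rightarrow> 'a \<Rightarrow> 'a set" where
  "subdifferential \<Omega> u x = {p. \<forall>y\<in>\<Omega>. p \<bullet> (y - x) + u x \<le> u y}"

definition subdifferential_image ::
  "'a::euclidean_space set \<Rightarrow> ('a \<Rightarrow> real) \<Rightarrow> 'a set \<Rightarrow> 'a set" where
  "subdifferential_image \<Omega> u E = (\<Union>x\<in>E. subdifferential \<Omega> u x)"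

text \<open>
  Subdifferential images of Borel sets need not be Borel, but for convex \<open>u\<close> on an open convex
  \<open>\<Omega>\<close> they are Lebesgue measurable and the set function below is countably additive (vectors
  that are subgradients at two distinct points form a null set). So \<^const>\<open>measure_of\<close>, which
  would yield the zero measure for a set function that is not a measure, does not change its values.
\<close>

definition monge_ampere :: "'a::euclidean_space set \<Rightarrow> ('a \<Rightarrow> real) \<Rightarrow> 'a measure" where
  "monge_ampere \<Omega> u = measure_of \<Omega> (sets (restrict_space borel \<Omega>))
     (\<lambda>E. emeasure lebesgue (subdifferential_image \<Omega> u E))"

end

theory Submission
  imports Defs
begin

text \<open>
  Let \<open>U(p) = max {p \<bullet> x - u(x) | x \<in> closure \<Omega>}\<close> be the conjugate of \<open>u\<close>, and \<open>V\<close> that of \<open>v\<close>.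
  For almost every \<open>p\<close> the maximiser is unique and equals \<open>\<nabla>U(p)\<close>, so \<open>\<mu>\<^sub>u\<close> is the image under
  \<open>\<nabla>U\<close> of Lebesgue measure on \<open>{p. \<nabla>U(p) \<in> \<Omega>}\<close>. Moreover \<open>U \<le> V\<close>; where \<open>U = V\<close> the gradients
  agree almost everywhere, and where \<open>U < V\<close> the maximiser for \<open>v\<close> lies in \<open>\<Omega>\<close>. It therefore
  suffices to compare \<open>\<phi>(\<nabla>U)\<close> and \<open>\<phi>(\<nabla>V)\<close> in the mean over \<open>{U < V}\<close>.

  Raising \<open>U\<close> to the maximum of \<open>U\<close> and an affine function \<open>l(p) = p \<bullet> x\<^sub>0 - c\<close> replaces \<open>\<nabla>U\<close> by
  \<open>x\<^sub>0\<close> on \<open>D = {U < l}\<close>. If \<open>D\<close> is bounded, \<open>x\<^sub>0\<close> is the mean of \<open>\<nabla>U\<close> over \<open>D\<close>, because \<open>U = l\<close> on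
  its boundary; by Jensen's inequality for the concave \<open>\<phi>\<close> the integral of \<open>\<phi>(\<nabla>U)\<close> does not
  decrease. As \<open>V - \<delta>\<close> is a supremum of countably many such \<open>l\<close> and \<open>{U < V - \<delta>}\<close> is bounded,
  iterating and passing to the limit gives the comparison on \<open>{U < V - \<delta>}\<close>; finally \<open>\<delta> \<rightarrow> 0\<close>.
\<close>

subsection \<open>Gradients of suprema of affine functions\<close>

text \<open>This describes the attained maxima of affine functions with slopes in \<open>K\<close>.
  The class contains the conjugates and affine functions used below and is closed under binary
  maxima, so the iteration never leaves it.\<close>

definition subgradients_in :: "'a::euclidean_space set \<Rightarrow> ('a \<Rightarrow> real) \<Rightarrow> bool" where
  "subgradients_in K U \<longleftrightarrow> (\<forall>p. \<exists>x\<in>K. x \<in> subdifferential UNIV U p)"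

text \<open>One-sided quotients along the steps 1/(n+1). A sequential limit keeps
  \<open>grad\<close> Borel measurable; two-sided differentiability is expressed by comparing the
  directions \<open>e\<close> and \<open>- e\<close>.\<close>

definition difference_quotient :: "('a::euclidean_space \<Rightarrow> real) \<Rightarrow> 'a \<Rightarrow> nat \<Rightarrow> 'a \<Rightarrow> real" where
  "difference_quotient U e n p = real (Suc n) * (U (p + e /\<^sub>R real (Suc n)) - U p)"

text \<open>
  The value of \<open>grad U p\<close> is arbitrary where the limits do not exist.
\<close>

definition grad :: "('a::euclidean_space \<Rightarrow> real) \<Rightarrow> 'a \<Rightarrow> 'a" where
  "grad U p = (\<Sum>e\<in>Basis. lim (\<lambda>n. difference_quotient U e n p) *\<^sub>R e)"

section \<open>Subgradients, one-sided quotients and the Lipschitz bound\<close>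

lemma subgradientD: "x \<in> subdifferential UNIV U p \<Longrightarrow> x \<bullet> (q - p) + U p \<le> U q"
  by (simp add: subdifferential_def)

lemma subgradients_inE:
  assumes "subgradients_in K U"
  obtains x where "x \<in> K" "x \<in> subdifferential UNIV U p"
  using assms unfolding subgradients_in_def by blast

lemma subgradient_le_difference_quotient:
  assumes "x \<in> subdifferential UNIV U p"
  shows "x \<bullet> e \<le> difference_quotient U e n p"
proof -
  have "inverse (real (Suc n)) * (x \<bullet> e) \<le> U (p + e /\<^sub>R real (Suc n)) - U p"
    using subgradientD[OF assms, of "p + e /\<^sub>R real (Suc n)"] by (simp del: of_nat_Suc)
  then have "real (Suc n) * (inverse (real (Suc n)) * (x \<bullet> e)) \<le> difference_quotient U e n p"
    unfolding difference_quotient_def by (intro mult_left_mono) auto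
  then show ?thesis by (metis mult.assoc mult_1 of_nat_neq_0 right_inverse)
qed

lemma difference_quotient_le_subgradient:
  assumes "x \<in> subdifferential UNIV U (p + e /\<^sub>R real (Suc n))"
  shows "difference_quotient U e n p \<le> x \<bullet> e"
proof -
  have "U (p + e /\<^sub>R real (Suc n)) - U p \<le> inverse (real (Suc n)) * (x \<bullet> e)"
    using subgradientD[OF assms, of p] by (simp del: of_nat_Suc)
  then have "difference_quotient U e n p \<le> real (Suc n) * (inverse (real (Suc n)) * (x \<bullet> e))"
    unfolding difference_quotient_def by (intro mult_left_mono) auto
  then show ?thesis by (metis mult.assoc mult_1 of_nat_neq_0 right_inverse)
qed

lemma subgradients_in_lipschitz:
  assumes U: "subgradients_in K U" and R: "\<And>x. x \<in> K \<Longrightarrow> norm x \<le> R"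
  shows "\<bar>U p - U q\<bar> \<le> R * norm (p - q)"
proof -
  have *: "U p - U q \<le> R * norm (p - q)" for p q
  proof -
    obtain x where x: "x \<in> K" "x \<in> subdifferential UNIV U p"
      using U by (rule subgradients_inE)
    have "U p - U q \<le> x \<bullet> (p - q)"
      using subgradientD[OF x(2), of q] by (simp add: inner_diff_right)
    also have "\<dots> \<le> norm x * norm (p - q)" by (rule norm_cauchy_schwarz)
    also have "\<dots> \<le> R * norm (p - q)" using R[OF x(1)] by (simp add: mult_right_mono)
    finally show ?thesis .
  qed
  show ?thesis using *[of p q] *[of q p] by (simp add: norm_minus_commute abs_le_iff)
qed

lemma subgradients_in_continuous:
  assumes U: "subgradients_in K U" and "bounded K"
  shows "continuous_on UNIV U"
proof -
  obtain R where R: "R > 0" "\<And>x. x \<in> K \<Longrightarrow> norm x \<le> R"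
    using \<open>bounded K\<close> bounded_pos by blast
  have "R-lipschitz_on UNIV U"
    using R subgradients_in_lipschitz[OF U R(2)]
    by (intro lipschitz_onI) (auto simp: dist_norm dist_real_def)
  then show ?thesis by (rule lipschitz_on_continuous_on)
qed

lemma subgradients_in_borel:
  assumes "subgradients_in K U" "bounded K"
  shows "U \<in> borel_measurable borel"
  using borel_measurable_continuous_onI[OF subgradients_in_continuous[OF assms]] .

lemma difference_quotient_measurable:
  assumes [measurable]: "U \<in> borel_measurable borel"
  shows "difference_quotient U e n \<in> borel_measurable borel"
  unfolding difference_quotient_def[abs_def] by measurable

lemma grad_measurable:
  assumes [measurable]: "U \<in> borel_measurable borel"
  shows "grad U \<in> borel_measurable borel"
proof -
  note difference_quotient_measurable[measurable]
  show ?thesis unfolding grad_def[abs_def] by measurable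
qed

text \<open>
  Subgradients are monotone along a line, and the restriction of \<open>U\<close> to the line is differentiable
  at every continuity point of this monotone function.
\<close>

lemma countable_section_not_smooth:
  assumes U: "subgradients_in K U"
  shows "countable {t. \<not> (\<lambda>n. difference_quotient U e n (p + t *\<^sub>R e)
    + difference_quotient U (- e) n (p + t *\<^sub>R e)) \<longlonglongrightarrow> 0}" (is "countable {t. \<not> ?S t}")
proof -
  have "\<exists>s. \<forall>q. s q \<in> subdifferential UNIV U q"
    by (rule choice) (meson U subgradients_inE)
  then obtain s where s: "\<And>q. s q \<in> subdifferential UNIV U q" by blast
  define m where "m t = s (p + t *\<^sub>R e) \<bullet> e" for t
  have "mono m"
  proof (rule monoI)
    fix t t' :: real assume "t \<le> t'"
    show "m t \<le> m t'"
    proof (cases "t = t'")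
      case False
      with \<open>t \<le> t'\<close> have "t < t'" by simp
      have "(t' - t) * m t \<le> U (p + t' *\<^sub>R e) - U (p + t *\<^sub>R e)"
        using subgradientD[OF s, of "p + t *\<^sub>R e" "p + t' *\<^sub>R e"]
        by (simp add: m_def inner_diff_right algebra_simps)
      moreover have "U (p + t' *\<^sub>R e) - U (p + t *\<^sub>R e) \<le> (t' - t) * m t'"
        using subgradientD[OF s, of "p + t' *\<^sub>R e" "p + t *\<^sub>R e"]
        by (simp add: m_def inner_diff_right algebra_simps)
      ultimately have "(t' - t) * m t \<le> (t' - t) * m t'" by linarith
      with \<open>t < t'\<close> show ?thesis by simp
    qed simp
  qed
  \<comment> \<open>The sum is non-negative by the subgradient inequality at the point itself. From
    above, the subgradients at the two shifted points bound it by the increase of \<open>m\<close>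
    over an interval of radius 1/(n+1) about \<open>t\<close>.\<close>
  have "?S t" if "isCont m t" for t
  proof (rule tendsto_sandwich[OF _ _ tendsto_const])
    show "\<forall>\<^sub>F n in sequentially. 0 \<le> difference_quotient U e n (p + t *\<^sub>R e)
      + difference_quotient U (- e) n (p + t *\<^sub>R e)"
    proof (rule always_eventually, rule allI)
      fix n
      show "0 \<le> difference_quotient U e n (p + t *\<^sub>R e) + difference_quotient U (- e) n (p + t *\<^sub>R e)"
        using subgradient_le_difference_quotient[OF s[of "p + t *\<^sub>R e"], of e n]
          subgradient_le_difference_quotient[OF s[of "p + t *\<^sub>R e"], of "- e" n] by simp
    qed
    show "\<forall>\<^sub>F n in sequentially. difference_quotient U e n (p + t *\<^sub>R e)
      + difference_quotient U (- e) n (p + t *\<^sub>R e)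
      \<le> m (t + inverse (real (Suc n))) - m (t - inverse (real (Suc n)))"
    proof (rule always_eventually, rule allI)
      fix n
      show "difference_quotient U e n (p + t *\<^sub>R e) + difference_quotient U (- e) n (p + t *\<^sub>R e)
        \<le> m (t + inverse (real (Suc n))) - m (t - inverse (real (Suc n)))"
        using difference_quotient_le_subgradient[OF s, where p = "p + t *\<^sub>R e" and e = e and n = n]
          difference_quotient_le_subgradient[OF s, where p = "p + t *\<^sub>R e" and e = "- e" and n = n]
        by (simp add: m_def algebra_simps del: of_nat_Suc)
    qed
    have lim: "(\<lambda>n. t + inverse (real (Suc n))) \<longlonglongrightarrow> t + 0" "(\<lambda>n. t - inverse (real (Suc n))) \<longlonglongrightarrow> t - 0"
      by (intro tendsto_intros LIMSEQ_inverse_real_of_nat)+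
    have "(\<lambda>n. m (t + inverse (real (Suc n))) - m (t - inverse (real (Suc n)))) \<longlonglongrightarrow> m t - m t"
      using lim by (intro tendsto_diff isCont_tendsto_compose[OF that]) simp_all
    then show "(\<lambda>n. m (t + inverse (real (Suc n))) - m (t - inverse (real (Suc n)))) \<longlonglongrightarrow> 0" by simp
  qed
  then have "{t. \<not> ?S t} \<subseteq> {t. \<not> isCont m t}" by blast
  then show ?thesis using mono_ctble_discont[OF \<open>mono m\<close>] countable_subset by blast
qed

text \<open>
  Averaging the measures of the translates \<open>N - t e\<close>, \<open>0 \<le> t \<le> 1\<close>, allows one to apply Tonelli's
  theorem without splitting off the direction \<open>e\<close> from the space.
\<close>

lemma emeasure_lborel_eq_0_of_countable_sections:
  fixes N :: "'a::euclidean_space set"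
  assumes N[measurable]: "N \<in> sets borel" and c: "\<And>p. countable {t::real. p + t *\<^sub>R e \<in> N}"
  shows "emeasure lborel N = 0"
proof -
  have shift: "emeasure lborel N = (\<integral>\<^sup>+ p. indicator N (p + t *\<^sub>R e) \<partial>lborel)" for t
  proof -
    have "emeasure lborel N = (\<integral>\<^sup>+ p. indicator N p \<partial>distr lborel borel ((+) (t *\<^sub>R e)))"
      by (simp add: lborel_distr_plus)
    also have "\<dots> = (\<integral>\<^sup>+ p. indicator N (p + t *\<^sub>R e) \<partial>lborel)"
      by (subst nn_integral_distr) (auto simp: add.commute)
    finally show ?thesis .
  qed
  have "emeasure lborel N = (\<integral>\<^sup>+ t. emeasure lborel N * indicator {0..1::real} t \<partial>lborel)"
    by (subst nn_integral_cmult_indicator) auto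
  also have "\<dots> = (\<integral>\<^sup>+ t. (\<integral>\<^sup>+ p. indicator N (p + t *\<^sub>R e) * indicator {0..1::real} t \<partial>lborel) \<partial>lborel)"
    
  proof (rule nn_integral_cong)
    fix t :: real
    show "emeasure lborel N * indicator {0..1} t = (\<integral>\<^sup>+ p. indicator N (p + t *\<^sub>R e) * indicator {0..1} t \<partial>lborel)"
      unfolding shift[of t] by (rule nn_integral_multc[symmetric]) measurable
  qed
  also have "\<dots> = (\<integral>\<^sup>+ p. (\<integral>\<^sup>+ t. indicator N (p + t *\<^sub>R e) * indicator {0..1::real} t \<partial>lborel) \<partial>lborel)"
    by (rule lborel_pair.Fubini') measurable
  also have "\<dots> = (\<integral>\<^sup>+ p. 0 \<partial>(lborel :: 'a measure))"
  proof (rule nn_integral_cong)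
    fix p :: 'a
    have "AE t in lborel. t \<notin> {t::real. p + t *\<^sub>R e \<in> N}"
      using countable_imp_null_set_lborel[OF c[of p]] by (rule AE_not_in)
    then have "(\<integral>\<^sup>+ t. indicator N (p + t *\<^sub>R e) * indicator {0..1::real} t \<partial>lborel) = (\<integral>\<^sup>+ t. 0 \<partial>(lborel :: real measure))"
      by (intro nn_integral_cong_AE) (auto elim!: eventually_mono)
    then show "(\<integral>\<^sup>+ t. indicator N (p + t *\<^sub>R e) * indicator {0..1::real} t \<partial>lborel) = 0" by simp
  qed
  finally show ?thesis by simp
qed

text \<open>For any subgradient \<open>x\<close>, the number \<open>x \<bullet> e\<close> lies
  between minus the quotient in direction \<open>- e\<close> and the quotient in direction
  \<open>e\<close>. The sum of these quotients tends to 0 off a Borel set that meets every line in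
  direction \<open>e\<close> in a countable set, hence off a null set.\<close>

lemma AE_difference_quotient:
  fixes U :: "'a::euclidean_space \<Rightarrow> real"
  assumes U: "subgradients_in K U" and K: "bounded K"
  shows "AE p in lborel. \<forall>x\<in>subdifferential UNIV U p. \<forall>e\<in>Basis.
    (\<lambda>n. difference_quotient U e n p) \<longlonglongrightarrow> x \<bullet> e"
proof -
  note [measurable] = subgradients_in_borel[OF U K] difference_quotient_measurable
  have "AE p in lborel. (\<lambda>n. difference_quotient U e n p + difference_quotient U (- e) n p) \<longlonglongrightarrow> 0" for e :: 'a
  proof -
    define N where "N = {p \<in> space borel. \<not> (\<lambda>n. difference_quotient U e n p + difference_quotient U (- e) n p) \<longlonglongrightarrow> 0}"
    have N: "N \<in> sets borel" unfolding N_def by measurable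
    have "N \<in> null_sets lborel"
      using N emeasure_lborel_eq_0_of_countable_sections[OF N, of e] countable_section_not_smooth[OF U, of e]
      by (auto simp: N_def null_sets_def)
    from AE_not_in[OF this] show ?thesis by (auto simp: N_def elim!: eventually_mono)
  qed
  then have "AE p in lborel. \<forall>e\<in>Basis. (\<lambda>n. difference_quotient U e n p + difference_quotient U (- e) n p) \<longlonglongrightarrow> 0"
    by (intro AE_finite_allI) auto
  then show ?thesis
  proof (eventually_elim, intro ballI)
    fix p x e :: 'a
    assume "\<forall>e\<in>Basis. (\<lambda>n. difference_quotient U e n p + difference_quotient U (- e) n p) \<longlonglongrightarrow> 0"
      and x: "x \<in> subdifferential UNIV U p" and e: "e \<in> Basis"
    then have lim: "(\<lambda>n. difference_quotient U e n p + difference_quotient U (- e) n p) \<longlonglongrightarrow> 0" by blast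
    have "(\<lambda>n. difference_quotient U e n p - x \<bullet> e) \<longlonglongrightarrow> 0"
    proof (rule tendsto_sandwich[OF _ _ tendsto_const lim])
      show "\<forall>\<^sub>F n in sequentially. 0 \<le> difference_quotient U e n p - x \<bullet> e"
        using subgradient_le_difference_quotient[OF x] by simp
      show "\<forall>\<^sub>F n in sequentially. difference_quotient U e n p - x \<bullet> e
        \<le> difference_quotient U e n p + difference_quotient U (- e) n p"
      proof (rule always_eventually, rule allI)
        fix n
        show "difference_quotient U e n p - x \<bullet> e \<le> difference_quotient U e n p + difference_quotient U (- e) n p"
          using subgradient_le_difference_quotient[OF x, of "- e" n] by simp
      qed
    qed
    then show "(\<lambda>n. difference_quotient U e n p) \<longlonglongrightarrow> x \<bullet> e"
      by (simp add: LIM_zero_iff)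
  qed
qed

lemma AE_subgradient_eq_grad:
  assumes "subgradients_in K U" "bounded K"
  shows "AE p in lborel. \<forall>x\<in>subdifferential UNIV U p. x = grad U p"
  using AE_difference_quotient[OF assms]
proof (eventually_elim, intro ballI)
  fix p x
  assume "\<forall>x\<in>subdifferential UNIV U p. \<forall>e\<in>Basis. (\<lambda>n. difference_quotient U e n p) \<longlonglongrightarrow> x \<bullet> e"
    and "x \<in> subdifferential UNIV U p"
  then have "lim (\<lambda>n. difference_quotient U e n p) = x \<bullet> e" if "e \<in> Basis" for e
    using that limI by blast
  then have "grad U p = (\<Sum>e\<in>Basis. (x \<bullet> e) *\<^sub>R e)" unfolding grad_def by simp
  then show "x = grad U p" by (simp add: euclidean_representation)
qed

lemma AE_grad:
  assumes U: "subgradients_in K U" and K: "bounded K"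
  shows "AE p in lborel. grad U p \<in> K \<and> grad U p \<in> subdifferential UNIV U p
    \<and> (\<forall>x\<in>subdifferential UNIV U p. x = grad U p)
    \<and> (\<forall>e\<in>Basis. (\<lambda>n. difference_quotient U e n p) \<longlonglongrightarrow> grad U p \<bullet> e)"
  using AE_difference_quotient[OF U K] AE_subgradient_eq_grad[OF U K]
proof eventually_elim
  case (elim p)
  obtain x where "x \<in> K" "x \<in> subdifferential UNIV U p"
    using U by (rule subgradients_inE)
  moreover from this elim have "x = grad U p" by blast
  ultimately show ?case using elim by blast
qed

text \<open>An affine function that supports \<open>U\<close> at a contact point lies below
  \<open>V\<close> as well and touches it there, so it also supports \<open>V\<close>. Almost
  everywhere \<open>V\<close> has only one subgradient.\<close>

lemma AE_grad_eq_on_contact: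
  assumes U: "subgradients_in K U" and V: "subgradients_in L V" and K: "bounded K" "bounded L"
    and le: "\<And>p. U p \<le> V p"
  shows "AE p in lborel. U p = V p \<longrightarrow> grad U p = grad V p"
  using AE_grad[OF U K(1)] AE_grad[OF V K(2)]
proof eventually_elim
  case (elim p)
  show ?case
  proof
    assume "U p = V p"
    have "grad U p \<in> subdifferential UNIV V p"
      unfolding subdifferential_def
    proof (clarify)
      fix q
      have "grad U p \<bullet> (q - p) + U p \<le> U q" using elim subgradientD by blast
      then show "grad U p \<bullet> (q - p) + V p \<le> V q" using le[of q] \<open>U p = V p\<close> by linarith
    qed
    then show "grad U p = grad V p" using elim by blast
  qed
qed

subsection \<open>Comparison of mean values of gradients\<close>

lemma integral_lborel_shift:
  fixes f :: "'a::euclidean_space \<Rightarrow> real"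
  assumes [measurable]: "f \<in> borel_measurable borel"
  shows "(\<integral>p. f (p + a) \<partial>lborel) = (\<integral>p. f p \<partial>lborel)"
proof -
  have "(\<integral>p. f p \<partial>lborel) = (\<integral>p. f p \<partial>distr lborel borel ((+) a))"
    by (simp add: lborel_distr_plus)
  also have "\<dots> = (\<integral>p. f (p + a) \<partial>lborel)"
    by (subst integral_distr) (auto simp: add.commute)
  finally show ?thesis by simp
qed

text \<open>By translation invariance every difference quotient of \<open>w\<close> has integral 0.
  The Lipschitz bound and the bounded support dominate the quotients by a multiple of the indicator
  of one ball, so the limit inherits the value 0.\<close>

lemma
  fixes w g :: "'a::euclidean_space \<Rightarrow> real"
  assumes lip: "\<And>p q. \<bar>w p - w q\<bar> \<le> R * norm (p - q)"
    and supp: "\<And>p. w p \<noteq> 0 \<Longrightarrow> norm p \<le> r"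
    and g: "g \<in> borel_measurable borel"
    and lim: "AE p in lborel. (\<lambda>n. difference_quotient w e n p) \<longlonglongrightarrow> g p"
  shows integrable_directional_derivative: "integrable lborel g"
    and integral_directional_derivative_eq_0: "integral\<^sup>L lborel g = 0"
proof -
  have "R \<ge> 0" 
  proof -
    obtain b :: 'a where "b \<in> Basis" by (meson nonempty_Basis all_not_in_conv)
    then show ?thesis using lip[of b 0] by simp
  qed
  then have "R-lipschitz_on UNIV w"
    using lip by (intro lipschitz_onI) (auto simp: dist_norm dist_real_def)
  then have cont: "continuous_on UNIV w" by (rule lipschitz_on_continuous_on)
  then have [measurable]: "w \<in> borel_measurable borel" by (rule borel_measurable_continuous_onI)
  note [measurable] = difference_quotient_measurable
  have "bounded (w ` cball 0 r)"
    by (intro compact_imp_bounded compact_continuous_image continuous_on_subset[OF cont]) auto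
  then obtain B where B: "\<And>p. p \<in> cball 0 r \<Longrightarrow> norm (w p) \<le> B"
    unfolding bounded_iff by blast
  have int_w: "integrable lborel w"
    by (rule integrableI_bounded_set[where A = "cball 0 r" and B = B])
      (use B supp emeasure_lborel_cball_finite in auto)
  have int_w': "integrable lborel (\<lambda>p. w (p + a))" for a
  proof -
    have "integrable (distr lborel borel ((+) a)) w" using int_w by (simp add: lborel_distr_plus)
    then show ?thesis by (subst (asm) integrable_distr_eq) (auto simp: add.commute)
  qed
  have zero: "(\<integral>p. difference_quotient w e n p \<partial>lborel) = 0" for n
    unfolding difference_quotient_def
    by (simp add: Bochner_Integration.integral_diff int_w int_w' integral_lborel_shift del: of_nat_Suc)
  \<comment> \<open>The step has length at most \<open>norm e\<close>. Outside the ball of radius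
    \<open>r + norm e\<close> both \<open>p\<close> and the shifted point therefore miss the
    support, and the quotient is 0.\<close>
  have bound: "norm (difference_quotient w e n p) \<le> R * norm e * indicator (cball 0 (r + norm e)) p" for n p
  proof (cases "p \<in> cball 0 (r + norm e)")
    case True
    have "norm (difference_quotient w e n p) \<le> real (Suc n) * (R * norm (e /\<^sub>R real (Suc n)))"
      using lip[of "p + e /\<^sub>R real (Suc n)" p]
      unfolding difference_quotient_def norm_mult by (simp add: mult_left_mono del: of_nat_Suc)
    also have "\<dots> = R * norm e" by (simp add: field_simps del: of_nat_Suc)
    finally show ?thesis using True by simp
  next
    case False
    have "r < norm p" using False norm_ge_zero[of e] by (simp del: norm_ge_zero)
    then have "w p = 0" using supp[of p] by linarith
    moreover have "w (p + e /\<^sub>R real (Suc n)) = 0"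
    proof (rule ccontr)
      assume "w (p + e /\<^sub>R real (Suc n)) \<noteq> 0"
      then have *: "norm (p + e /\<^sub>R real (Suc n)) \<le> r" by (rule supp)
      have "norm (e /\<^sub>R real (Suc n)) \<le> norm e"
        by (simp add: divide_simps mult_left_le del: of_nat_Suc) (simp add: algebra_simps)
      with * norm_triangle_ineq4[of "p + e /\<^sub>R real (Suc n)" "e /\<^sub>R real (Suc n)"] False
      show False by simp
    qed
    ultimately show ?thesis using \<open>R \<ge> 0\<close> by (simp add: difference_quotient_def)
  qed
  have int_b: "integrable lborel (\<lambda>p. R * norm e * indicator (cball 0 (r + norm e)) p)"
    using emeasure_lborel_cball_finite by (intro integrable_mult_right integrable_real_indicator) auto
  have m: "g \<in> borel_measurable lborel" "\<And>n. difference_quotient w e n \<in> borel_measurable lborel"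
    using g by measurable
  show "integrable lborel g"
    by (rule integrable_dominated_convergence[OF m int_b lim]) (use bound in auto)
  have "(\<lambda>n. \<integral>p. difference_quotient w e n p \<partial>lborel) \<longlonglongrightarrow> integral\<^sup>L lborel g"
    by (rule integral_dominated_convergence[OF m int_b lim]) (use bound in auto)
  then show "integral\<^sup>L lborel g = 0" by (simp add: zero LIMSEQ_const_iff)
qed

text \<open>The difference \<open>V - U\<close> is Lipschitz with bounded support, so the previous
  result applies in each basis direction. Expanding \<open>q\<close> in the basis then gives all
  directions: \<open>grad U\<close> and \<open>grad V\<close> have the same mean.\<close>

lemma
  fixes U V :: "'a::euclidean_space \<Rightarrow> real"
  assumes U: "subgradients_in K U" and V: "subgradients_in K V" and K: "bounded K"
    and supp: "bounded {p. U p \<noteq> V p}"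
  shows integrable_grad_diff: "integrable lborel (\<lambda>p. q \<bullet> (grad V p - grad U p))"
    and integral_grad_diff_eq_0: "(\<integral>p. q \<bullet> (grad V p - grad U p) \<partial>lborel) = 0"
proof -
  obtain R where R: "\<And>x. x \<in> K \<Longrightarrow> norm x \<le> R"
    using K bounded_pos by blast
  obtain r where r: "\<And>p. U p \<noteq> V p \<Longrightarrow> norm p \<le> r"
    using supp unfolding bounded_iff by blast
  note [measurable] = grad_measurable subgradients_in_borel[OF U K] subgradients_in_borel[OF V K]
  have lip: "\<bar>(V p - U p) - (V q - U q)\<bar> \<le> (2 * R) * norm (p - q)" for p q
    using subgradients_in_lipschitz[OF U R, of p q] subgradients_in_lipschitz[OF V R, of p q] by linarith
  have lim: "AE p in lborel. (\<lambda>n. difference_quotient (\<lambda>p. V p - U p) e n p) \<longlonglongrightarrow> (grad V p - grad U p) \<bullet> e"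
    if "e \<in> Basis" for e
    using AE_grad[OF U K] AE_grad[OF V K]
  proof eventually_elim
    case (elim p)
    then have "(\<lambda>n. difference_quotient V e n p - difference_quotient U e n p)
      \<longlonglongrightarrow> grad V p \<bullet> e - grad U p \<bullet> e"
      using that by (intro tendsto_diff) auto
    moreover have "difference_quotient V e n p - difference_quotient U e n p
      = difference_quotient (\<lambda>p. V p - U p) e n p" for n
      by (simp add: difference_quotient_def algebra_simps)
    ultimately show ?case by (simp add: inner_diff_left)
  qed
  have m: "(\<lambda>p. (grad V p - grad U p) \<bullet> e) \<in> borel_measurable borel" for e
    by measurable
  have supp': "norm p \<le> r" if "V p - U p \<noteq> 0" for p
    using r that by force
  note * = integrable_directional_derivative[OF lip supp' m lim]
    integral_directional_derivative_eq_0[OF lip supp' m lim]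
  have eq: "q \<bullet> (grad V p - grad U p) = (\<Sum>e\<in>Basis. (q \<bullet> e) * ((grad V p - grad U p) \<bullet> e))" for p
    by (rule euclidean_inner)
  show "integrable lborel (\<lambda>p. q \<bullet> (grad V p - grad U p))"
    unfolding eq using * by (intro Bochner_Integration.integrable_sum integrable_mult_right) auto
  show "(\<integral>p. q \<bullet> (grad V p - grad U p) \<partial>lborel) = 0"
    unfolding eq using * by (subst Bochner_Integration.integral_sum) auto
qed

section \<open>Maxima with an affine function and Jensen's inequality\<close>

lemma subgradients_in_affine: "x \<in> K \<Longrightarrow> subgradients_in K (\<lambda>p. p \<bullet> x - c)"
  unfolding subgradients_in_def subdifferential_def
  by (auto intro!: bexI[of _ x] simp: inner_commute inner_diff_right)

lemma subgradients_in_max: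
  assumes U: "subgradients_in K U" and V: "subgradients_in K V"
  shows "subgradients_in K (\<lambda>p. max (U p) (V p))"
  unfolding subgradients_in_def
proof
  fix p
  obtain x where x: "x \<in> K" "\<And>q. x \<bullet> (q - p) + U p \<le> U q" using U by (meson subgradients_inE subgradientD)
  obtain y where y: "y \<in> K" "\<And>q. y \<bullet> (q - p) + V p \<le> V q" using V by (meson subgradients_inE subgradientD)
  show "\<exists>x\<in>K. x \<in> subdifferential UNIV (\<lambda>p. max (U p) (V p)) p"
  proof (cases "U p \<le> V p")
    case True
    then show ?thesis using y by (intro bexI[of _ y]) (auto simp: subdifferential_def max.coboundedI2)
  next
    case False
    then show ?thesis using x by (intro bexI[of _ x]) (auto simp: subdifferential_def max.coboundedI1)
  qed
qed

text \<open>A hyperplane separates the strict hypograph from the point above \<open>x0\<close> on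
  the graph. As \<open>x0\<close> is interior, the hyperplane is not vertical and can be solved for
  the last coordinate.\<close>

lemma exists_supergradient:
  fixes \<phi> :: "'a::euclidean_space \<Rightarrow> real"
  assumes conc: "concave_on K \<phi>" and x0: "x0 \<in> interior K"
  shows "\<exists>q. \<forall>x\<in>K. \<phi> x \<le> \<phi> x0 + q \<bullet> (x - x0)"
proof -
  define S where "S = {(x, s). x \<in> K \<and> s < \<phi> x}"
  have x0K: "x0 \<in> K" using x0 interior_subset by blast
  have "convex S"
  proof (rule convexI)
    fix y z :: "'a \<times> real" and a b :: real
    assume y: "y \<in> S" and z: "z \<in> S" and ab: "0 \<le> a" "0 \<le> b" "a + b = 1"
    have "a *\<^sub>R fst y + b *\<^sub>R fst z \<in> K"
      using conc y z ab by (auto simp: S_def concave_on_iff convex_def)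
    moreover have "a * snd y + b * snd z < \<phi> (a *\<^sub>R fst y + b *\<^sub>R fst z)"
    proof -
      have "a * snd y + b * snd z < a * \<phi> (fst y) + b * \<phi> (fst z)"
      proof (cases "a = 0")
        case True
        then show ?thesis using z ab by (auto simp: S_def)
      next
        case False
        then have "a * snd y < a * \<phi> (fst y)" "b * snd z \<le> b * \<phi> (fst z)"
          using y z ab by (auto simp: S_def intro!: mult_left_mono)
        then show ?thesis by linarith
      qed
      also have "\<dots> \<le> \<phi> (a *\<^sub>R fst y + b *\<^sub>R fst z)"
        using conc y z ab by (auto simp: S_def concave_on_iff)
      finally show ?thesis .
    qed
    ultimately show "a *\<^sub>R y + b *\<^sub>R z \<in> S" by (cases y; cases z) (simp add: S_def)
  qed
  moreover have "(x0, \<phi> x0 - 1) \<in> S" using x0K by (simp add: S_def)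
  moreover have "(x0, \<phi> x0) \<notin> S" by (simp add: S_def)
  ultimately obtain ab c where "ab \<noteq> 0" and sep: "\<forall>y\<in>S. ab \<bullet> y \<le> c" "\<forall>y\<in>{(x0, \<phi> x0)}. c \<le> ab \<bullet> y"
    using separating_hyperplane_sets[of S "{(x0, \<phi> x0)}"] by force
  obtain a b where ab: "ab = (a, b)" by (cases ab)
  have below: "a \<bullet> x + b * s \<le> a \<bullet> x0 + b * \<phi> x0" if "x \<in> K" "s < \<phi> x" for x s
    using sep that by (force simp: S_def ab)
  \<comment> \<open>The strict hypograph omits the graph itself, which is reached by letting
    \<open>s\<close> increase to \<open>\<phi> x\<close>.\<close>
  have le: "a \<bullet> x + b * \<phi> x \<le> a \<bullet> x0 + b * \<phi> x0" if "x \<in> K" for x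
  proof (rule tendsto_le[OF _ tendsto_const])
    show "((\<lambda>s. a \<bullet> x + b * s) \<longlongrightarrow> a \<bullet> x + b * \<phi> x) (at_left (\<phi> x))"
      by (intro tendsto_intros)
    show "\<forall>\<^sub>F s in at_left (\<phi> x). a \<bullet> x + b * s \<le> a \<bullet> x0 + b * \<phi> x0"
      using below[OF that] by (auto simp: eventually_at_filter)
  qed auto
  have "b \<ge> 0" using below[OF x0K, of "\<phi> x0 - 1"] by (simp add: algebra_simps)
  moreover have "b \<noteq> 0"
  proof
    \<comment> \<open>A vertical hyperplane would make \<open>a \<bullet> x\<close> maximal over
      \<open>K\<close> at \<open>x0\<close>, but a short move from \<open>x0\<close> in direction
      \<open>a\<close> stays in \<open>K\<close> and increases it.\<close>
    assume "b = 0"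
    then have "a \<noteq> 0" using \<open>ab \<noteq> 0\<close> ab by (auto simp: zero_prod_def)
    obtain d where d: "d > 0" "cball x0 d \<subseteq> K" using x0 by (meson mem_interior_cball)
    have "x0 + (d / norm a) *\<^sub>R a \<in> K" using d \<open>a \<noteq> 0\<close> by (auto simp: dist_norm)
    from le[OF this] \<open>b = 0\<close> have "(d / norm a) * (a \<bullet> a) \<le> 0" by (simp add: inner_add_right)
    moreover have "(d / norm a) * (a \<bullet> a) > 0" using d \<open>a \<noteq> 0\<close> by simp
    ultimately show False by linarith
  qed
  ultimately have "b > 0" by simp
  have "\<phi> x \<le> \<phi> x0 + (- (1 / b) *\<^sub>R a) \<bullet> (x - x0)" if "x \<in> K" for x
    using le[OF that] \<open>b > 0\<close> by (simp add: field_simps inner_diff_right)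
  then show ?thesis by blast
qed

lemma integrable_indicator_grad:
  assumes U: "subgradients_in K U" and K: "bounded K"
    and P: "P \<in> sets borel" "bounded P"
    and \<phi>: "\<phi> \<in> borel_measurable borel" "\<And>x. \<bar>\<phi> x\<bar> \<le> C"
  shows "integrable lborel (\<lambda>p. indicator P p * \<phi> (grad U p) :: real)"
proof -
  note [measurable] = grad_measurable[OF subgradients_in_borel[OF U K]] \<phi>(1)
  show ?thesis
    using integrableI_bounded_set_indicator[of P lborel "\<lambda>p. \<phi> (grad U p)" C]
      P \<phi>(2) emeasure_bounded_finite[OF P(2)] by simp
qed

text \<open>Jensen's inequality in the form of its proof: the supergradient inequality at
  \<open>x0\<close> is integrated, and its linear term drops out because both gradients have the
  same mean. The set \<open>P\<close> may exceed the set where \<open>U\<close> is raised, so one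
  \<open>P\<close> serves all stages of the iteration.\<close>

lemma integral_grad_max_affine:
  fixes U :: "'a::euclidean_space \<Rightarrow> real"
  assumes U: "subgradients_in K U" and K: "bounded K" and x0: "x0 \<in> K"
    and P: "P \<in> sets borel" "bounded P" "{p. U p < p \<bullet> x0 - c} \<subseteq> P"
    and \<phi>: "\<phi> \<in> borel_measurable borel" "\<And>x. \<bar>\<phi> x\<bar> \<le> C"
    and q: "\<And>x. x \<in> K \<Longrightarrow> \<phi> x \<le> \<phi> x0 + q \<bullet> (x - x0)"
  shows "(\<integral>p. indicator P p * \<phi> (grad U p) \<partial>lborel)
    \<le> (\<integral>p. indicator P p * \<phi> (grad (\<lambda>p. max (U p) (p \<bullet> x0 - c)) p) \<partial>lborel)"
proof -
  define V where "V = (\<lambda>p. max (U p) (p \<bullet> x0 - c))"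
  have V: "subgradients_in K V"
    unfolding V_def by (rule subgradients_in_max[OF U subgradients_in_affine[OF x0]])
  have "{p. U p \<noteq> V p} \<subseteq> P" using P(3) by (auto simp: V_def max_def)
  then have supp: "bounded {p. U p \<noteq> V p}" using P(2) bounded_subset by blast
  note affine = subgradients_in_affine[OF x0, of c]
  have contact: "AE p in lborel. U p = V p \<longrightarrow> grad U p = grad V p"
    "AE p in lborel. p \<bullet> x0 - c = V p \<longrightarrow> grad (\<lambda>p. p \<bullet> x0 - c) p = grad V p"
    by (intro AE_grad_eq_on_contact[OF U V K K] AE_grad_eq_on_contact[OF affine V K K]; simp add: V_def)+
  \<comment> \<open>Where \<open>U\<close> is raised, \<open>grad V\<close> equals \<open>x0\<close>
    and this is the supergradient inequality. Elsewhere the gradients agree almost everywhere and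
    both sides are 0.\<close>
  have AE_ineq: "AE p in lborel. q \<bullet> (grad V p - grad U p)
    \<le> indicator P p * \<phi> (grad V p) - indicator P p * \<phi> (grad U p)"
    using AE_grad[OF U K] AE_grad[OF affine K] contact
  proof eventually_elim
    case (elim p)
    show ?case
    proof (cases "U p < p \<bullet> x0 - c")
      case True
      have "x0 \<in> subdifferential UNIV (\<lambda>p. p \<bullet> x0 - c) p"
        by (simp add: subdifferential_def inner_diff_right inner_commute)
      then have "grad V p = x0" using elim True by (auto simp: V_def)
      moreover have "p \<in> P" using True P(3) by blast
      moreover have "\<phi> (grad U p) \<le> \<phi> x0 + q \<bullet> (grad U p - x0)" using q elim by blast
      ultimately show ?thesis by (simp add: inner_diff_right)
    next
      case False
      then have "grad U p = grad V p" using elim by (auto simp: V_def)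
      then show ?thesis by simp
    qed
  qed
  note int = integrable_indicator_grad[OF U K P(1,2) \<phi>] integrable_indicator_grad[OF V K P(1,2) \<phi>]
  have "0 = (\<integral>p. q \<bullet> (grad V p - grad U p) \<partial>lborel)"
    using integral_grad_diff_eq_0[OF U V K supp] by simp
  also have "\<dots> \<le> (\<integral>p. indicator P p * \<phi> (grad V p) - indicator P p * \<phi> (grad U p) \<partial>lborel)"
    by (rule integral_mono_AE[OF integrable_grad_diff[OF U V K supp] _ AE_ineq])
      (intro Bochner_Integration.integrable_diff int)
  also have "\<dots> = (\<integral>p. indicator P p * \<phi> (grad V p) \<partial>lborel) - (\<integral>p. indicator P p * \<phi> (grad U p) \<partial>lborel)"
    by (intro Bochner_Integration.integral_diff int)
  finally show ?thesis by (simp add: V_def)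
qed

text \<open>The subgradient inequality survives pointwise limits, so every cluster point of the
  gradients is a subgradient of \<open>Z\<close>. Almost everywhere there is only one, and
  compactness of \<open>K\<close> turns this into convergence.\<close>

lemma AE_grad_tendsto:
  fixes W :: "nat \<Rightarrow> 'a::euclidean_space \<Rightarrow> real"
  assumes W: "\<And>k. subgradients_in K (W k)" and Z: "subgradients_in K Z" and K: "compact K"
    and lim: "\<And>p. (\<lambda>k. W k p) \<longlonglongrightarrow> Z p"
  shows "AE p in lborel. (\<lambda>k. grad (W k) p) \<longlonglongrightarrow> grad Z p"
proof -
  have "AE p in lborel. \<forall>k. grad (W k) p \<in> K \<and> grad (W k) p \<in> subdifferential UNIV (W k) p"
    unfolding AE_all_countable using AE_grad[OF W compact_imp_bounded[OF K]]
    by (auto elim: eventually_mono)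
  then show ?thesis using AE_grad[OF Z compact_imp_bounded[OF K]]
  proof eventually_elim
    case (elim p)
    then have uniq: "\<And>x. x \<in> subdifferential UNIV Z p \<Longrightarrow> x = grad Z p" by blast
    let ?x = "\<lambda>k. grad (W k) p"
    show ?case
    proof (rule ccontr)
      assume "\<not> ?x \<longlonglongrightarrow> grad Z p"
      then obtain e where e: "e > 0" "\<not> (\<forall>\<^sub>F k in sequentially. dist (?x k) (grad Z p) < e)"
        unfolding tendsto_iff by blast
      then have "\<exists>\<^sub>F k in sequentially. dist (?x k) (grad Z p) \<ge> e"
        by (simp add: frequently_def not_le)
      then have "infinite {k. dist (?x k) (grad Z p) \<ge> e}"
        by (simp add: frequently_cofinite flip: cofinite_eq_sequentially)
      from infinite_enumerate[OF this]
      obtain r :: "nat \<Rightarrow> nat" where r: "strict_mono r" "\<forall>k. dist (?x (r k)) (grad Z p) \<ge> e" by blast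
      have in_K: "?x (r k) \<in> K" for k using elim(1) by simp
      obtain l s where l: "l \<in> K" and s: "strict_mono s" and ls: "((\<lambda>k. ?x (r k)) \<circ> s) \<longlonglongrightarrow> l"
        using seq_compactE[OF compact_imp_seq_compact[OF K], of "\<lambda>k. ?x (r k)"] in_K by metis
      have W_lim: "(\<lambda>k. W (r (s k)) q) \<longlonglongrightarrow> Z q" for q
        using LIMSEQ_subseq_LIMSEQ[OF lim strict_mono_o[OF r(1) s]] by (simp add: o_def)
      have "l \<in> subdifferential UNIV Z p"
        unfolding subdifferential_def
      proof clarify
        fix q
        show "l \<bullet> (q - p) + Z p \<le> Z q"
        proof (rule LIMSEQ_le)
          show "(\<lambda>k. ?x (r (s k)) \<bullet> (q - p) + W (r (s k)) p) \<longlonglongrightarrow> l \<bullet> (q - p) + Z p"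
            using ls by (intro tendsto_intros W_lim) (simp add: o_def)
          show "(\<lambda>k. W (r (s k)) q) \<longlonglongrightarrow> Z q" by (rule W_lim)
          show "\<exists>N. \<forall>k\<ge>N. ?x (r (s k)) \<bullet> (q - p) + W (r (s k)) p \<le> W (r (s k)) q"
            using elim(1) by (simp add: subgradientD)
        qed
      qed
      then have "l = grad Z p" by (rule uniq)
      with ls have "(\<lambda>k. ?x (r (s k))) \<longlonglongrightarrow> grad Z p" by (simp add: o_def)
      then have "(\<lambda>k. dist (?x (r (s k))) (grad Z p)) \<longlonglongrightarrow> 0" by (rule tendsto_dist_iff[THEN iffD1])
      then have "e \<le> 0" using r(2) by (intro LIMSEQ_le_const) auto
      with e show False by simp
    qed
  qed
qed

section \<open>Iteration over countably many affine functions\<close>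

primrec max_affine :: "('a::euclidean_space \<Rightarrow> real) \<Rightarrow> (nat \<Rightarrow> 'a) \<Rightarrow> (nat \<Rightarrow> real) \<Rightarrow> nat \<Rightarrow> 'a \<Rightarrow> real" where
  "max_affine U x c 0 = U"
| "max_affine U x c (Suc k) = (\<lambda>p. max (max_affine U x c k p) (p \<bullet> x k - c k))"

text \<open>Adding the affine functions one at a time never lowers the integral over
  \<open>{p. U p < Z p}\<close>. The iterates increase to the maximum of \<open>U\<close> and
  \<open>Z\<close>, and dominated convergence carries the inequality to the limit.\<close>

lemma integral_grad_mono:
  fixes U Z :: "'a::euclidean_space \<Rightarrow> real" and x :: "nat \<Rightarrow> 'a"
  assumes U: "subgradients_in K U" and Z: "subgradients_in K Z" and K: "compact K"
    and x: "\<And>k. x k \<in> interior K"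
    and le: "\<And>k p. p \<bullet> x k - c k \<le> Z p"
    and approx: "\<And>p \<epsilon>. \<epsilon> > 0 \<Longrightarrow> \<exists>k. Z p - \<epsilon> < p \<bullet> x k - c k"
    and P: "bounded {p. U p < Z p}"
    and \<phi>: "\<phi> \<in> borel_measurable borel" "\<And>x. \<bar>\<phi> x\<bar> \<le> C" "continuous_on K \<phi>" "concave_on K \<phi>"
  shows "(\<integral>p. indicator {p. U p < Z p} p * \<phi> (grad U p) \<partial>lborel)
    \<le> (\<integral>p. indicator {p. U p < Z p} p * \<phi> (grad Z p) \<partial>lborel)"
proof -
  let ?P = "{p. U p < Z p}"
  define W where "W = max_affine U x c"
  \<comment> \<open>The iterates start at \<open>U\<close>, which may exceed \<open>Z\<close>
    somewhere; hence they converge to this maximum and not to \<open>Z\<close> itself.\<close>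
  define Y where "Y = (\<lambda>p. max (U p) (Z p))"
  have Kb: "bounded K" using K by (rule compact_imp_bounded)
  have xK: "x k \<in> K" for k using x interior_subset by blast
  note [measurable] = subgradients_in_borel[OF U Kb] subgradients_in_borel[OF Z Kb]
  have Pm: "?P \<in> sets borel"
    by measurable
  have Y: "subgradients_in K Y" unfolding Y_def by (rule subgradients_in_max[OF U Z])
  have W: "subgradients_in K (W k)" for k
    unfolding W_def by (induction k) (auto simp: U intro!: subgradients_in_max subgradients_in_affine xK)
  have WU: "U p \<le> W k p" for k p
    unfolding W_def by (induction k) (auto simp: le_max_iff_disj)
  have WY: "W k p \<le> Y p" for k p
    unfolding W_def by (induction k) (auto simp: Y_def max.coboundedI2 le)
  have W_mono: "incseq (\<lambda>k. W k p)" for p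
    by (rule incseq_SucI) (simp add: W_def)
  have W_lim: "(\<lambda>k. W k p) \<longlonglongrightarrow> Y p" for p
  proof (rule increasing_tendsto)
    show "\<forall>\<^sub>F k in sequentially. W k p \<le> Y p" using WY by simp
    fix y assume y: "y < Y p"
    show "\<forall>\<^sub>F k in sequentially. y < W k p"
    proof (cases "y < U p")
      case True
      then show ?thesis using less_le_trans[OF True WU] by simp
    next
      case False
      with y have "Z p - y > 0" by (auto simp: Y_def)
      from approx[OF this, of p] obtain k where "y < p \<bullet> x k - c k" by auto
      \<comment> \<open>The affine function with index \<open>k\<close> enters only at stage
        \<open>Suc k\<close>; later stages are larger still.\<close>
      then have "y < W (Suc k) p" by (simp add: W_def less_max_iff_disj)
      then have "y < W j p" if "j \<ge> Suc k" for j
        using incseqD[OF W_mono that] by (rule less_le_trans)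
      then show ?thesis unfolding eventually_sequentially by blast
    qed
  qed
  have step: "(\<integral>p. indicator ?P p * \<phi> (grad (W k) p) \<partial>lborel)
    \<le> (\<integral>p. indicator ?P p * \<phi> (grad (W (Suc k)) p) \<partial>lborel)" for k
  proof -
    obtain q where q: "\<And>y. y \<in> K \<Longrightarrow> \<phi> y \<le> \<phi> (x k) + q \<bullet> (y - x k)"
      using exists_supergradient[OF \<phi>(4) x] by blast
    have "{p. W k p < p \<bullet> x k - c k} \<subseteq> ?P"
    proof clarify
      fix p assume "W k p < p \<bullet> x k - c k"
      then show "U p < Z p" using WU[of p k] le[of p k] by linarith
    qed
    from integral_grad_max_affine[OF W Kb xK Pm P this \<phi>(1,2) q]
    show ?thesis by (simp add: W_def)
  qed
  have U_le: "(\<integral>p. indicator ?P p * \<phi> (grad U p) \<partial>lborel)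
    \<le> (\<integral>p. indicator ?P p * \<phi> (grad (W k) p) \<partial>lborel)" for k
    by (induction k) (simp add: W_def, use step order_trans in blast)
  have lim: "(\<lambda>k. \<integral>p. indicator ?P p * \<phi> (grad (W k) p) \<partial>lborel)
    \<longlonglongrightarrow> (\<integral>p. indicator ?P p * \<phi> (grad Y p) \<partial>lborel)"
  proof (rule integral_dominated_convergence[where w = "\<lambda>p. C * indicator ?P p"])
    show "(\<lambda>p. indicator ?P p * \<phi> (grad Y p)) \<in> borel_measurable lborel"
      using integrable_indicator_grad[OF Y Kb Pm P \<phi>(1,2)] by (rule borel_measurable_integrable)
    show "(\<lambda>p. indicator ?P p * \<phi> (grad (W k) p)) \<in> borel_measurable lborel" for k
      using integrable_indicator_grad[OF W Kb Pm P \<phi>(1,2)] by (rule borel_measurable_integrable)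
    show "integrable lborel (\<lambda>p. C * indicator ?P p)"
      using Pm emeasure_bounded_finite[OF P] by (intro integrable_mult_right integrable_real_indicator) auto
    show "AE p in lborel. norm (indicator ?P p * \<phi> (grad (W k) p)) \<le> C * indicator ?P p" for k
      using \<phi>(2) by (auto simp: indicator_def)
    have "AE p in lborel. \<forall>k. grad (W k) p \<in> K"
      unfolding AE_all_countable using AE_grad[OF W Kb] by (auto elim: eventually_mono)
    then show "AE p in lborel. (\<lambda>k. indicator ?P p * \<phi> (grad (W k) p)) \<longlonglongrightarrow> indicator ?P p * \<phi> (grad Y p)"
      using AE_grad_tendsto[OF W Y K W_lim] AE_grad[OF Y Kb]
    proof eventually_elim
      case (elim p)
      then show ?case
        by (intro tendsto_mult tendsto_const continuous_on_tendsto_compose[OF \<phi>(3)]) auto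
    qed
  qed
  have "(\<integral>p. indicator ?P p * \<phi> (grad U p) \<partial>lborel) \<le> (\<integral>p. indicator ?P p * \<phi> (grad Y p) \<partial>lborel)"
    using U_le by (intro LIMSEQ_le_const[OF lim]) auto
  also have "\<dots> = (\<integral>p. indicator ?P p * \<phi> (grad Z p) \<partial>lborel)"
  proof (rule integral_cong_AE)
    show "(\<lambda>p. indicator ?P p * \<phi> (grad Y p)) \<in> borel_measurable lborel"
      using integrable_indicator_grad[OF Y Kb Pm P \<phi>(1,2)] by (rule borel_measurable_integrable)
    show "(\<lambda>p. indicator ?P p * \<phi> (grad Z p)) \<in> borel_measurable lborel"
      using integrable_indicator_grad[OF Z Kb Pm P \<phi>(1,2)] by (rule borel_measurable_integrable)
    \<comment> \<open>On \<open>?P\<close> the functions \<open>Y\<close> and \<open>Z\<close>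
      coincide, so the contact lemma identifies their gradients.\<close>
    show "AE p in lborel. indicator ?P p * \<phi> (grad Y p) = indicator ?P p * \<phi> (grad Z p)"
      using AE_grad_eq_on_contact[OF Z Y Kb Kb, unfolded Y_def, OF max.cobounded2]
      by (auto elim!: eventually_mono simp: Y_def indicator_def max_def split: if_splits)
  qed
  finally show ?thesis .
qed

subsection \<open>Conjugates and the Monge-Ampere measure\<close>

text \<open>The Legendre-Fenchel conjugate of \<open>u\<close> extended by infinity outside
  \<open>K\<close>. It is used for compact non-empty \<open>K\<close> and \<open>u\<close>
  continuous on \<open>K\<close>, where the supremum is an attained maximum.\<close>

definition conjugate_on :: "'a::euclidean_space set \<Rightarrow> ('a \<Rightarrow> real) \<Rightarrow> 'a \<Rightarrow> real" where
  "conjugate_on K u p = (SUP x\<in>K. p \<bullet> x - u x)"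

section \<open>Maximisers, subgradients and the image of Lebesgue measure\<close>

lemma conjugate_on_attained:
  assumes "compact K" "K \<noteq> {}" "continuous_on K u"
  obtains x where "x \<in> K" "conjugate_on K u p = p \<bullet> x - u x"
    "\<And>y. y \<in> K \<Longrightarrow> p \<bullet> y - u y \<le> p \<bullet> x - u x"
proof -
  have "continuous_on K (\<lambda>x. p \<bullet> x - u x)" using assms(3) by (intro continuous_intros)
  from continuous_attains_sup[OF assms(1,2) this]
  obtain x where x: "x \<in> K" "\<And>y. y \<in> K \<Longrightarrow> p \<bullet> y - u y \<le> p \<bullet> x - u x" by blast
  moreover have "conjugate_on K u p = p \<bullet> x - u x"
    unfolding conjugate_on_def using x by (intro cSup_eq_maximum) auto
  ultimately show thesis using that by blast
qed

lemma conjugate_on_ge: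
  assumes "compact K" "continuous_on K u" "x \<in> K"
  shows "p \<bullet> x - u x \<le> conjugate_on K u p"
proof -
  have "K \<noteq> {}" using assms(3) by blast
  from conjugate_on_attained[OF assms(1) this assms(2), of p] show ?thesis using assms(3) by metis
qed

lemma subgradient_conjugate_on:
  assumes "compact K" "continuous_on K u" "x \<in> K" and eq: "conjugate_on K u p = p \<bullet> x - u x"
  shows "x \<in> subdifferential UNIV (conjugate_on K u) p"
  unfolding subdifferential_def
proof clarify
  fix q
  show "x \<bullet> (q - p) + conjugate_on K u p \<le> conjugate_on K u q"
    using conjugate_on_ge[OF assms(1-3), of q] eq by (simp add: inner_diff_right inner_commute)
qed

lemma subgradients_in_conjugate_on:
  assumes "compact K" "K \<noteq> {}" "continuous_on K u"
  shows "subgradients_in K (conjugate_on K u)"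
  unfolding subgradients_in_def
  using conjugate_on_attained[OF assms] subgradient_conjugate_on[OF assms(1,3)] by metis

text \<open>Equality in the Fenchel-Young inequality: \<open>p\<close> is a subgradient at
  \<open>x\<close> exactly when \<open>x\<close> maximises \<open>p \<bullet> y - u y\<close>.
  Maximality over \<open>\<Omega>\<close> extends to the closure by continuity.\<close>

lemma subdifferential_iff_conjugate_on:
  assumes "bounded \<Omega>" and u: "continuous_on (closure \<Omega>) u" and x: "x \<in> \<Omega>"
  shows "p \<in> subdifferential \<Omega> u x \<longleftrightarrow> conjugate_on (closure \<Omega>) u p = p \<bullet> x - u x"
proof
  have K: "compact (closure \<Omega>)" "closure \<Omega> \<noteq> {}"
    using assms closure_subset by (auto simp: compact_closure)
  have xK: "x \<in> closure \<Omega>" using x closure_subset by blast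
  {
    assume "p \<in> subdifferential \<Omega> u x"
    then have le: "p \<bullet> y - u y \<le> p \<bullet> x - u x" if "y \<in> \<Omega>" for y
      using that by (auto simp: subdifferential_def inner_diff_right algebra_simps)
    obtain y where y: "y \<in> closure \<Omega>" "conjugate_on (closure \<Omega>) u p = p \<bullet> y - u y"
      using conjugate_on_attained[OF K u] by blast
    have "continuous_on (closure \<Omega>) (\<lambda>y. p \<bullet> y - u y)" using u by (intro continuous_intros)
    from continuous_le_on_closure[OF this y(1) le]
    show "conjugate_on (closure \<Omega>) u p = p \<bullet> x - u x"
      using conjugate_on_ge[OF K(1) u xK, of p] y(2) by simp
  }
  {
    assume eq: "conjugate_on (closure \<Omega>) u p = p \<bullet> x - u x"
    show "p \<in> subdifferential \<Omega> u x"
      unfolding subdifferential_def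
    proof clarify
      fix y assume "y \<in> \<Omega>"
      then have "y \<in> closure \<Omega>" using closure_subset by blast
      from conjugate_on_ge[OF K(1) u this, of p] eq
      show "p \<bullet> (y - x) + u x \<le> u y" by (simp add: inner_diff_right)
    qed
  }
qed

text \<open>A vector \<open>p\<close> lies in the subdifferential image of \<open>E\<close> iff some
  maximiser for \<open>p\<close> lies in \<open>E\<close>. For almost every \<open>p\<close> the
  only maximiser is the gradient of the conjugate, so the two sets differ by a null set.\<close>

lemma emeasure_subdifferential_image:
  fixes u :: "'a::euclidean_space \<Rightarrow> real"
  assumes \<Omega>: "bounded \<Omega>" "\<Omega> \<noteq> {}" and u: "continuous_on (closure \<Omega>) u"
    and E: "E \<in> sets borel" "E \<subseteq> \<Omega>"
  shows "emeasure lebesgue (subdifferential_image \<Omega> u E)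
    = emeasure lborel (grad (conjugate_on (closure \<Omega>) u) -` E)"
proof -
  let ?U = "conjugate_on (closure \<Omega>) u"
  let ?A = "grad ?U -` E" and ?B = "subdifferential_image \<Omega> u E"
  have K: "compact (closure \<Omega>)" "closure \<Omega> \<noteq> {}"
    using \<Omega> closure_subset by (auto simp: compact_closure)
  have U: "subgradients_in (closure \<Omega>) ?U" by (rule subgradients_in_conjugate_on[OF K u])
  note bK = compact_imp_bounded[OF K(1)]
  have A: "?A \<in> sets borel"
    using measurable_sets[OF grad_measurable[OF subgradients_in_borel[OF U bK]] E(1)] by simp
  have AE_lborel: "AE p in lborel. p \<in> ?A \<longleftrightarrow> p \<in> ?B"
    using AE_grad[OF U bK]
  proof eventually_elim
    case (elim p)
    obtain y where y: "y \<in> closure \<Omega>" "?U p = p \<bullet> y - u y"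
      using conjugate_on_attained[OF K u] by blast
    then have "y = grad ?U p" using elim subgradient_conjugate_on[OF K(1) u] by blast
    show ?case
    proof
      assume "p \<in> ?A"
      then have "y \<in> E" using \<open>y = grad ?U p\<close> by simp
      moreover from this have "p \<in> subdifferential \<Omega> u y"
        using subdifferential_iff_conjugate_on[OF \<Omega>(1) u] y(2) E(2) by blast
      ultimately show "p \<in> ?B" unfolding subdifferential_image_def by blast
    next
      assume "p \<in> ?B"
      then obtain x where x: "x \<in> E" "p \<in> subdifferential \<Omega> u x"
        unfolding subdifferential_image_def by blast
      then have "?U p = p \<bullet> x - u x" "x \<in> closure \<Omega>"
        using subdifferential_iff_conjugate_on[OF \<Omega>(1) u] E(2) closure_subset by blast+
      then have "x = grad ?U p" using elim subgradient_conjugate_on[OF K(1) u] by blast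
      then show "p \<in> ?A" using x by simp
    qed
  qed
  then have AE: "AE p in lebesgue. p \<in> ?A \<longleftrightarrow> p \<in> ?B" by (rule AE_completion)
  have A': "?A \<in> sets lebesgue" using A by simp
  \<comment> \<open>The image need not be Borel, but outside a Borel null set it coincides with the
    Borel set \<open>?A\<close>.\<close>
  have B: "?B \<in> sets lebesgue"
  proof -
    obtain N where N: "\<And>p. p \<in> space lborel - N \<Longrightarrow> p \<in> ?A \<longleftrightarrow> p \<in> ?B" "N \<in> null_sets lborel"
      using AE_E3[OF AE_lborel] by metis
    show ?thesis
      by (rule sets_completionI[of _ "?A - N" "?B \<inter> N" N]) (use N A in auto)
  qed
  have "emeasure lebesgue ?B = emeasure lebesgue ?A"
    using AE by (intro emeasure_eq_AE A' B) (auto elim: eventually_mono)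
  then show ?thesis using A by simp
qed

text \<open>On Borel subsets of \<open>\<Omega>\<close> the defining set function takes the values
  of an image measure. It is therefore countably additive, and \<open>measure_of\<close> reproduces
  it instead of collapsing to 0.\<close>

lemma monge_ampere_eq_distr:
  fixes u :: "'a::euclidean_space \<Rightarrow> real"
  assumes \<Omega>: "open \<Omega>" "bounded \<Omega>" "\<Omega> \<noteq> {}" and u: "continuous_on (closure \<Omega>) u"
  defines "G \<equiv> grad (conjugate_on (closure \<Omega>) u)"
  shows "monge_ampere \<Omega> u = distr (restrict_space lborel (G -` \<Omega>)) (restrict_space borel \<Omega>) G"
    and "G \<in> measurable (restrict_space lborel (G -` \<Omega>)) (restrict_space borel \<Omega>)"
    and "G \<in> borel_measurable borel"
proof -
  let ?R = "restrict_space lborel (G -` \<Omega>)" and ?S = "restrict_space borel \<Omega>"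
  have K: "compact (closure \<Omega>)" "closure \<Omega> \<noteq> {}"
    using \<Omega> closure_subset by (auto simp: compact_closure)
  have U: "subgradients_in (closure \<Omega>) (conjugate_on (closure \<Omega>) u)"
    by (rule subgradients_in_conjugate_on[OF K u])
  show G: "G \<in> borel_measurable borel"
    unfolding G_def by (rule grad_measurable[OF subgradients_in_borel[OF U compact_imp_bounded[OF K(1)]]])
  have G\<Omega>: "G -` \<Omega> \<in> sets borel"
    using measurable_sets[OF G, of \<Omega>] \<Omega>(1) by simp
  show GR: "G \<in> measurable ?R ?S"
    using G by (intro measurable_restrict_space2 measurable_restrict_space1) (auto simp: space_restrict_space)
  have "monge_ampere \<Omega> u = measure_of \<Omega> (sets ?S) (emeasure (distr ?R ?S G))"
    unfolding monge_ampere_def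
  proof (rule measure_of_eq)
    show "sets ?S \<subseteq> Pow \<Omega>" using sets.space_closed[of ?S] by (simp add: space_restrict_space)
    fix E assume "E \<in> sigma_sets \<Omega> (sets ?S)"
    then have E: "E \<in> sets ?S"
      using sets.sigma_sets_eq[of ?S] by (simp add: space_restrict_space)
    then have E': "E \<in> sets borel" "E \<subseteq> \<Omega>" using \<Omega>(1) by (auto simp: sets_restrict_space_iff)
    have "emeasure (distr ?R ?S G) E = emeasure ?R (G -` E)"
      using E' by (subst emeasure_distr[OF GR E]) (auto simp: space_restrict_space intro!: arg_cong[where f = "emeasure ?R"])
    also have "\<dots> = emeasure lborel (G -` E)"
      using G\<Omega> E' by (intro emeasure_restrict_space) auto
    finally show "emeasure lebesgue (subdifferential_image \<Omega> u E) = emeasure (distr ?R ?S G) E"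
      using emeasure_subdifferential_image[OF \<Omega>(2,3) u E'] by (simp add: G_def)
  qed
  also have "\<dots> = distr ?R ?S G"
    using measure_of_of_measure[of "distr ?R ?S G"] by (simp add: space_restrict_space)
  finally show "monge_ampere \<Omega> u = distr ?R ?S G" .
qed

lemma nn_integral_monge_ampere:
  fixes u f :: "'a::euclidean_space \<Rightarrow> real"
  assumes \<Omega>: "open \<Omega>" "bounded \<Omega>" "\<Omega> \<noteq> {}" and u: "continuous_on (closure \<Omega>) u"
    and f: "f \<in> borel_measurable borel"
  defines "G \<equiv> grad (conjugate_on (closure \<Omega>) u)"
  shows "(\<integral>\<^sup>+ x. ennreal (f x) \<partial>monge_ampere \<Omega> u)
    = (\<integral>\<^sup>+ p. ennreal (f (G p)) * indicator \<Omega> (G p) \<partial>lborel)"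
proof -
  note M = monge_ampere_eq_distr[OF \<Omega> u, folded G_def]
  have G\<Omega>: "G -` \<Omega> \<in> sets borel"
    using measurable_sets[OF M(3), of \<Omega>] \<Omega>(1) by simp
  have "(\<integral>\<^sup>+ x. ennreal (f x) \<partial>monge_ampere \<Omega> u) = (\<integral>\<^sup>+ p. ennreal (f (G p)) \<partial>restrict_space lborel (G -` \<Omega>))"
    unfolding M(1) using f by (intro nn_integral_distr[OF M(2)]) (simp add: measurable_restrict_space1)
  also have "\<dots> = (\<integral>\<^sup>+ p. ennreal (f (G p)) * indicator (G -` \<Omega>) p \<partial>lborel)"
    using G\<Omega> by (intro nn_integral_restrict_space) simp
  finally show ?thesis by (simp add: indicator_def vimage_def)
qed

text \<open>
  For large \<open>p\<close>, moving from a maximiser in direction \<open>p\<close> reaches the boundary after a distance so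
  short that \<open>v\<close> changes by less than \<open>\<delta>\<close>.
\<close>

lemma bounded_conjugate_on_gap:
  fixes u v :: "'a::euclidean_space \<Rightarrow> real"
  assumes \<Omega>: "open \<Omega>" "bounded \<Omega>" "\<Omega> \<noteq> {}"
    and u: "continuous_on (closure \<Omega>) u" and v: "continuous_on (closure \<Omega>) v"
    and eq: "\<And>x. x \<in> frontier \<Omega> \<Longrightarrow> u x = v x" and "\<delta> > 0"
  shows "bounded {p. conjugate_on (closure \<Omega>) u p < conjugate_on (closure \<Omega>) v p - \<delta>}"
proof -
  have K: "compact (closure \<Omega>)" "closure \<Omega> \<noteq> {}"
    using \<Omega> closure_subset by (auto simp: compact_closure)
  have frK: "frontier \<Omega> \<subseteq> closure \<Omega>" by (simp add: frontier_def)
  obtain \<eta> where \<eta>: "\<eta> > 0" "\<And>x y. x \<in> closure \<Omega> \<Longrightarrow> y \<in> closure \<Omega> \<Longrightarrow> dist y x < \<eta> \<Longrightarrow> dist (v y) (v x) < \<delta>"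
    using compact_uniformly_continuous[OF v K(1)] \<open>\<delta> > 0\<close> unfolding uniformly_continuous_on_def by metis
  obtain B where B: "B > 0" "\<And>x. x \<in> closure \<Omega> \<Longrightarrow> \<bar>v x\<bar> \<le> B"
    using compact_imp_bounded[OF compact_continuous_image[OF v K(1)]] unfolding bounded_pos by auto
  have "norm p \<le> 2 * B / \<eta>"
    if p: "conjugate_on (closure \<Omega>) u p < conjugate_on (closure \<Omega>) v p - \<delta>" for p
  proof (rule ccontr)
    \<comment> \<open>The threshold forces every step along \<open>p\<close> of length below
      \<open>2 * B / norm p\<close> to be shorter than \<open>\<eta>\<close>, the modulus of
      continuity of \<open>v\<close> for \<open>\<delta>\<close>.\<close>
    assume "\<not> norm p \<le> 2 * B / \<eta>"
    then have np: "2 * B / \<eta> < norm p" by simp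
    have "0 < 2 * B / \<eta>" using B \<eta> by simp
    with np have "norm p > 0" by linarith
    then have "p \<noteq> 0" by simp
    obtain x where x: "x \<in> closure \<Omega>" "conjugate_on (closure \<Omega>) v p = p \<bullet> x - v x"
      using conjugate_on_attained[OF K v] by blast
    have "x \<notin> frontier \<Omega>"
    proof
      assume "x \<in> frontier \<Omega>"
      then show False
        using conjugate_on_ge[OF K(1) u x(1), of p] eq x(2) p \<open>\<delta> > 0\<close> by simp
    qed
    then have "x \<in> interior \<Omega>" using x(1) by (simp add: frontier_def)
    from ray_to_frontier[OF \<Omega>(2) this \<open>p \<noteq> 0\<close>]
    obtain d where d: "0 < d" "x + d *\<^sub>R p \<in> frontier \<Omega>" by blast
    define y where "y = x + d *\<^sub>R p"
    have y: "y \<in> closure \<Omega>" "u y = v y" using d frK eq by (auto simp: y_def)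
    have "p \<bullet> y - v y < p \<bullet> x - v x - \<delta>"
      using conjugate_on_ge[OF K(1) u y(1), of p] y(2) x(2) p by linarith
    \<comment> \<open>At the boundary point \<open>y\<close> the values of \<open>u\<close> and
      \<open>v\<close> agree, so \<open>p \<bullet> y - v y\<close> is at most the conjugate of
      \<open>u\<close>. The gap thus makes \<open>v\<close> rise by more than
      \<open>\<delta>\<close>, while the bound \<open>2 * B\<close> on this rise limits
      \<open>d\<close>.\<close>
    then have gap: "\<delta> + d * (norm p * norm p) < v y - v x"
      by (simp add: y_def inner_add_right dot_square_norm power2_eq_square)
    then have "d * norm p * norm p < 2 * B"
      using B(2)[OF x(1)] B(2)[OF y(1)] \<open>\<delta> > 0\<close> by (simp add: mult.assoc)
    also have "2 * B < \<eta> * norm p" using np \<eta>(1) by (simp add: field_simps)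
    finally have "d * norm p < \<eta>" using \<open>norm p > 0\<close> by simp
    then have "dist y x < \<eta>" using d(1) by (simp add: y_def dist_norm)
    from \<eta>(2)[OF x(1) y(1) this] have "v y - v x < \<delta>" by (simp add: dist_real_def)
    moreover have "d * (norm p * norm p) \<ge> 0" using d(1) by simp
    ultimately show False using gap by linarith
  qed
  then show ?thesis unfolding bounded_iff by blast
qed

section \<open>Comparison of the gradients of the two conjugates\<close>

lemma subgradients_in_diff_const:
  "subgradients_in K U \<Longrightarrow> subgradients_in K (\<lambda>p. U p - c)"
  by (simp add: subgradients_in_def subdifferential_def add_diff_eq)

lemma grad_diff_const: "grad (\<lambda>p. U p - c) = grad U"
  by (simp add: grad_def[abs_def] difference_quotient_def)

text \<open>The iteration is applied with \<open>Z = V - \<delta>\<close>. Its affine functions have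
  as slopes a sequence \<open>x\<close> dense in \<open>\<Omega>\<close> and as constants
  \<open>v (x k) + \<delta>\<close>; by continuity of \<open>v\<close> their supremum is
  \<open>V - \<delta>\<close>. The positive \<open>\<delta>\<close> makes the set of comparison
  bounded.\<close>

lemma integral_grad_conjugate_on_mono:
  fixes u v \<phi> :: "'a::euclidean_space \<Rightarrow> real"
  assumes \<Omega>: "open \<Omega>" "bounded \<Omega>" "\<Omega> \<noteq> {}"
    and u: "continuous_on (closure \<Omega>) u" and v: "continuous_on (closure \<Omega>) v"
    and eq: "\<And>x. x \<in> frontier \<Omega> \<Longrightarrow> u x = v x" and \<delta>: "\<delta> > 0"
    and \<phi>: "\<phi> \<in> borel_measurable borel" "\<And>x. \<bar>\<phi> x\<bar> \<le> C" "continuous_on (closure \<Omega>) \<phi>" "concave_on (closure \<Omega>) \<phi>"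
  defines "U \<equiv> conjugate_on (closure \<Omega>) u" and "V \<equiv> conjugate_on (closure \<Omega>) v"
  shows "(\<integral>p. indicator {p. U p < V p - \<delta>} p * \<phi> (grad U p) \<partial>lborel)
    \<le> (\<integral>p. indicator {p. U p < V p - \<delta>} p * \<phi> (grad V p) \<partial>lborel)"
proof -
  have K: "compact (closure \<Omega>)" "closure \<Omega> \<noteq> {}"
    using \<Omega> closure_subset by (auto simp: compact_closure)
  have U: "subgradients_in (closure \<Omega>) U" and V: "subgradients_in (closure \<Omega>) V"
    unfolding U_def V_def by (intro subgradients_in_conjugate_on K u v)+
  obtain T where T: "countable T" "T \<subseteq> \<Omega>" "\<Omega> \<subseteq> closure T" using separable by blast
  have "T \<noteq> {}" using T(3) \<Omega>(3) by auto
  define x where "x = from_nat_into T"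
  have range_x: "range x = T" using T(1) \<open>T \<noteq> {}\<close> by (simp add: x_def)
  have cl: "closure T = closure \<Omega>"
    using T(2,3) by (simp add: closure_minimal closure_mono subset_antisym)
  have x\<Omega>: "x k \<in> \<Omega>" for k using range_x T(2) by blast
  have "\<Omega> \<subseteq> interior (closure \<Omega>)" using \<Omega>(1) by (simp add: interior_maximal closure_subset)
  then have x: "x k \<in> interior (closure \<Omega>)" for k using x\<Omega> by blast
  have le: "p \<bullet> x k - (v (x k) + \<delta>) \<le> V p - \<delta>" for p k
    using conjugate_on_ge[OF K(1) v, of "x k" p] x\<Omega>[of k] closure_subset unfolding V_def by fastforce
  have approx: "\<exists>k. V p - \<delta> - \<epsilon> < p \<bullet> x k - (v (x k) + \<delta>)" if "\<epsilon> > 0" for p \<epsilon>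
  proof (rule ccontr)
    assume "\<nexists>k. V p - \<delta> - \<epsilon> < p \<bullet> x k - (v (x k) + \<delta>)"
    then have "\<not> V p - \<delta> - \<epsilon> < p \<bullet> x k - (v (x k) + \<delta>)" for k by blast
    then have *: "p \<bullet> x k - v (x k) \<le> V p - \<epsilon>" for k by (smt (verit))
    have le_T: "p \<bullet> y - v y \<le> V p - \<epsilon>" if "y \<in> T" for y using * that range_x by blast
    obtain y where y: "y \<in> closure \<Omega>" "V p = p \<bullet> y - v y"
      using conjugate_on_attained[OF K v] unfolding V_def by blast
    have "continuous_on (closure T) (\<lambda>y. p \<bullet> y - v y)"
      unfolding cl using v by (intro continuous_intros)
    then have "p \<bullet> y - v y \<le> V p - \<epsilon>"
      by (rule continuous_le_on_closure[OF _ _ le_T]) (simp add: cl y)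
    then show False using y(2) \<open>\<epsilon> > 0\<close> by simp
  qed
  have "bounded {p. U p < V p - \<delta>}"
    unfolding U_def V_def by (rule bounded_conjugate_on_gap[OF \<Omega> u v eq \<delta>])
  from integral_grad_mono[OF U subgradients_in_diff_const[OF V] K(1) x le approx this \<phi>]
  show ?thesis by (simp add: grad_diff_const)
qed

lemma nn_integral_indicator_grad:
  assumes U: "subgradients_in K U" and K: "bounded K"
    and P: "P \<in> sets borel" "bounded P"
    and \<phi>: "\<phi> \<in> borel_measurable borel" "\<And>x. \<bar>\<phi> x\<bar> \<le> C" "\<And>x. 0 \<le> \<phi> x"
  shows "(\<integral>\<^sup>+ p. ennreal (\<phi> (grad U p)) * indicator P p \<partial>lborel)
    = ennreal (\<integral>p. indicator P p * \<phi> (grad U p) \<partial>lborel)"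
proof -
  have "(\<integral>\<^sup>+ p. ennreal (\<phi> (grad U p)) * indicator P p \<partial>lborel)
    = (\<integral>\<^sup>+ p. ennreal (indicator P p * \<phi> (grad U p)) \<partial>lborel)"
    by (intro nn_integral_cong) (simp add: indicator_def)
  also have "\<dots> = ennreal (\<integral>p. indicator P p * \<phi> (grad U p) \<partial>lborel)"
    using \<phi>(3) by (intro nn_integral_eq_integral integrable_indicator_grad[OF U K P \<phi>(1,2)]) auto
  finally show ?thesis .
qed

lemma nn_integral_grad_conjugate_on_mono:
  fixes u v \<phi> :: "'a::euclidean_space \<Rightarrow> real"
  assumes \<Omega>: "open \<Omega>" "bounded \<Omega>" "\<Omega> \<noteq> {}"
    and u: "continuous_on (closure \<Omega>) u" and v: "continuous_on (closure \<Omega>) v"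
    and eq: "\<And>x. x \<in> frontier \<Omega> \<Longrightarrow> u x = v x"
    and \<phi>: "\<phi> \<in> borel_measurable borel" "\<And>x. \<bar>\<phi> x\<bar> \<le> C" "continuous_on (closure \<Omega>) \<phi>" "concave_on (closure \<Omega>) \<phi>"
      "\<And>x. 0 \<le> \<phi> x"
  defines "U \<equiv> conjugate_on (closure \<Omega>) u" and "V \<equiv> conjugate_on (closure \<Omega>) v"
  shows "(\<integral>\<^sup>+ p. ennreal (\<phi> (grad U p)) * indicator {p. U p < V p} p \<partial>lborel)
    \<le> (\<integral>\<^sup>+ p. ennreal (\<phi> (grad V p)) * indicator {p. U p < V p} p \<partial>lborel)"
proof -
  have K: "compact (closure \<Omega>)" "closure \<Omega> \<noteq> {}"
    using \<Omega> closure_subset by (auto simp: compact_closure)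
  note bK = compact_imp_bounded[OF K(1)]
  have U: "subgradients_in (closure \<Omega>) U" and V: "subgradients_in (closure \<Omega>) V"
    unfolding U_def V_def by (intro subgradients_in_conjugate_on K u v)+
  note [measurable] = subgradients_in_borel[OF U bK] subgradients_in_borel[OF V bK] grad_measurable \<phi>(1)
  define P where "P m = {p. U p < V p - inverse (real (Suc m))}" for m
  have Pm[measurable]: "P m \<in> sets borel" for m unfolding P_def by measurable
  have Pb: "bounded (P m)" for m
    unfolding P_def U_def V_def by (rule bounded_conjugate_on_gap[OF \<Omega> u v eq]) auto
  have "incseq P"
  proof (rule incseq_SucI)
    fix m
    have "inverse (real (Suc (Suc m))) \<le> inverse (real (Suc m))" by (intro le_imp_inverse_le) auto
    then show "P m \<subseteq> P (Suc m)" unfolding P_def by (intro Collect_mono impI) linarith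
  qed
  have UP: "{p. U p < V p} = (\<Union>m. P m)"
  proof (intro subset_antisym subsetI)
    fix p assume "p \<in> {p. U p < V p}"
    then have "0 < V p - U p" by simp
    from reals_Archimedean[OF this] obtain m where "inverse (real (Suc m)) < V p - U p" by blast
    then show "p \<in> (\<Union>m. P m)" by (auto simp: P_def algebra_simps)
  next
    fix p assume "p \<in> (\<Union>m. P m)"
    then obtain m where "U p < V p - inverse (real (Suc m))" by (auto simp: P_def)
    moreover have "inverse (real (Suc m)) > 0" by simp
    ultimately have "U p < V p" by linarith
    then show "p \<in> {p. U p < V p}" by simp
  qed
  have sup: "(\<integral>\<^sup>+ p. ennreal (\<phi> (G p)) * indicator {p. U p < V p} p \<partial>lborel)
    = (SUP m. \<integral>\<^sup>+ p. ennreal (\<phi> (G p)) * indicator (P m) p \<partial>lborel)"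
    if [measurable]: "G \<in> borel_measurable borel" for G
  proof -
    \<comment> \<open>Monotone convergence appears here as continuity from below of the measure with
      density \<open>\<phi> (G p)\<close>.\<close>
    have "emeasure (density lborel (\<lambda>p. ennreal (\<phi> (G p)))) (\<Union>m. P m)
      = (SUP m. emeasure (density lborel (\<lambda>p. ennreal (\<phi> (G p)))) (P m))"
      by (rule SUP_emeasure_incseq[symmetric]) (use \<open>incseq P\<close> in auto)
    then show ?thesis unfolding UP by (simp add: emeasure_density)
  qed
  have "(SUP m. \<integral>\<^sup>+ p. ennreal (\<phi> (grad U p)) * indicator (P m) p \<partial>lborel)
    \<le> (SUP m. \<integral>\<^sup>+ p. ennreal (\<phi> (grad V p)) * indicator (P m) p \<partial>lborel)"
  proof (rule SUP_mono')
    fix m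
    have "(\<integral>p. indicator (P m) p * \<phi> (grad U p) \<partial>lborel) \<le> (\<integral>p. indicator (P m) p * \<phi> (grad V p) \<partial>lborel)"
      unfolding P_def U_def V_def
      by (rule integral_grad_conjugate_on_mono[OF \<Omega> u v eq _ \<phi>(1-4)]) auto
    then show "(\<integral>\<^sup>+ p. ennreal (\<phi> (grad U p)) * indicator (P m) p \<partial>lborel)
      \<le> (\<integral>\<^sup>+ p. ennreal (\<phi> (grad V p)) * indicator (P m) p \<partial>lborel)"
      using nn_integral_indicator_grad[OF U bK Pm Pb \<phi>(1,2,5)] nn_integral_indicator_grad[OF V bK Pm Pb \<phi>(1,2,5)]
      by (simp add: ennreal_leI)
  qed
  then show ?thesis by (simp add: sup)
qed

section \<open>Splitting along the contact set of the conjugates\<close>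

theorem proposition2p6:
  fixes \<Omega> :: "(real ^ 'n) set" and u v \<phi> :: "real ^ 'n \<Rightarrow> real"
  assumes "convex \<Omega>" and "open \<Omega>" and "bounded \<Omega>"
    and "W1_infinity \<Omega> u" and "continuous_on (closure \<Omega>) u" and "convex_on \<Omega> u"
    and "W1_infinity \<Omega> v" and "continuous_on (closure \<Omega>) v" and "convex_on \<Omega> v"
    and "\<And>x. x \<in> frontier \<Omega> \<Longrightarrow> u x = v x"
    and "\<And>x. x \<in> \<Omega> \<Longrightarrow> u x \<ge> v x"
    and "continuous_on (closure \<Omega>) \<phi>" and "concave_on (closure \<Omega>) \<phi>"
    and "\<And>x. x \<in> closure \<Omega> \<Longrightarrow> \<phi> x \<ge> 0"
  shows "(\<integral>\<^sup>+ x. ennreal (\<phi> x) \<partial>monge_ampere \<Omega> u) \<le> (\<integral>\<^sup>+ x. ennreal (\<phi> x) \<partial>monge_ampere \<Omega> v)"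
proof (cases "\<Omega> = {}")
  case True
  have "space (monge_ampere \<Omega> u) = \<Omega>" by (simp add: monge_ampere_def space_measure_of_conv)
  then show ?thesis using True by (simp add: nn_integral_empty)
next
  case False
  note \<Omega> = assms(2,3) False and u = assms(5) and v = assms(8) and eq = assms(10)
  let ?K = "closure \<Omega>"
  have K: "compact ?K" "?K \<noteq> {}"
    using \<Omega> closure_subset by (auto simp: compact_closure)
  note bK = compact_imp_bounded[OF K(1)]
  \<comment> \<open>Extension by 0 makes the integrand Borel, bounded and non-negative on the whole
    space. Almost every gradient lies in \<open>?K\<close>, where nothing changes.\<close>
  define \<psi> where "\<psi> x = (if x \<in> ?K then \<phi> x else 0)" for x
  have \<psi>_eq: "\<psi> x = \<phi> x" if "x \<in> ?K" for x using that by (simp add: \<psi>_def)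
  have \<psi>_m[measurable]: "\<psi> \<in> borel_measurable borel"
    unfolding \<psi>_def[abs_def]
    using borel_measurable_continuous_on_indicator[OF _ assms(12)]
    by (simp add: indicator_def of_bool_def if_distrib[of "\<lambda>c. c * _"] cong: if_cong)
  obtain C where C: "C > 0" "\<And>x. x \<in> ?K \<Longrightarrow> \<bar>\<phi> x\<bar> \<le> C"
    using compact_imp_bounded[OF compact_continuous_image[OF assms(12) K(1)]] unfolding bounded_pos by auto
  have \<psi>_C: "\<bar>\<psi> x\<bar> \<le> C" for x using C by (simp add: \<psi>_def)
  have \<psi>_cont: "continuous_on ?K \<psi>" using assms(12) \<psi>_eq by (simp cong: continuous_on_cong)
  have \<psi>_conc: "concave_on ?K \<psi>"
    using assms(13) unfolding concave_on_iff convex_def by (simp add: \<psi>_eq)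
  have \<psi>_nonneg: "0 \<le> \<psi> x" for x using assms(14) by (simp add: \<psi>_def)
  define U where "U = conjugate_on ?K u"
  define V where "V = conjugate_on ?K v"
  let ?P = "{p. U p < V p}"
  have U: "subgradients_in ?K U" and V: "subgradients_in ?K V"
    unfolding U_def V_def by (intro subgradients_in_conjugate_on K u v)+
  note [measurable] = subgradients_in_borel[OF U bK] subgradients_in_borel[OF V bK] grad_measurable
  have [measurable]: "\<Omega> \<in> sets borel" using \<Omega>(1) by simp
  have vu: "v x \<le> u x" if "x \<in> ?K" for x
    using that assms(10,11) closure_Un_frontier[of \<Omega>] by fastforce
  \<comment> \<open>Conjugation reverses order: a maximiser for \<open>u\<close> gives at least the
    same value for the smaller \<open>v\<close>.\<close>
  have UV: "U p \<le> V p" for p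
  proof -
    obtain x where x: "x \<in> ?K" "U p = p \<bullet> x - u x"
      using conjugate_on_attained[OF K u] unfolding U_def by blast
    then show ?thesis using conjugate_on_ge[OF K(1) v x(1), of p] vu[OF x(1)] unfolding V_def by linarith
  qed
  have AE_off: "AE p in lborel. U p = V p \<longrightarrow> grad U p = grad V p"
    by (rule AE_grad_eq_on_contact[OF U V bK bK UV])
  have AE_on: "AE p in lborel. U p < V p \<longrightarrow> grad V p \<in> \<Omega>"
    using AE_grad[OF V bK]
  proof (eventually_elim, intro impI)
    fix p
    assume grad_V: "grad V p \<in> ?K \<and> grad V p \<in> subdifferential UNIV V p
      \<and> (\<forall>x\<in>subdifferential UNIV V p. x = grad V p)
      \<and> (\<forall>e\<in>Basis. (\<lambda>n. difference_quotient V e n p) \<longlonglongrightarrow> grad V p \<bullet> e)" and "U p < V p"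
    obtain x where x: "x \<in> ?K" "V p = p \<bullet> x - v x"
      using conjugate_on_attained[OF K v] unfolding V_def by blast
    then have "x = grad V p"
      using subgradient_conjugate_on[OF K(1) v] grad_V unfolding V_def by blast
    \<comment> \<open>On the boundary \<open>u = v\<close>, so a maximiser for \<open>v\<close>
      there would give \<open>U p \<ge> V p\<close>.\<close>
    have "x \<notin> frontier \<Omega>"
    proof
      assume "x \<in> frontier \<Omega>"
      then show False
        using conjugate_on_ge[OF K(1) u x(1), of p] eq x(2) \<open>U p < V p\<close> unfolding U_def by simp
    qed
    then have "x \<in> \<Omega>" using x(1) \<Omega>(1) by (simp add: frontier_def interior_open)
    then show "grad V p \<in> \<Omega>" using \<open>x = grad V p\<close> by simp
  qed
  have MA: "(\<integral>\<^sup>+ x. ennreal (\<phi> x) \<partial>monge_ampere \<Omega> w)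
    = (\<integral>\<^sup>+ p. ennreal (\<psi> (grad (conjugate_on ?K w) p)) * indicator \<Omega> (grad (conjugate_on ?K w) p) \<partial>lborel)"
    if w: "continuous_on ?K w" for w
  proof -
    have "(\<integral>\<^sup>+ x. ennreal (\<phi> x) \<partial>monge_ampere \<Omega> w) = (\<integral>\<^sup>+ x. ennreal (\<psi> x) \<partial>monge_ampere \<Omega> w)"
      using closure_subset[of \<Omega>]
      by (intro nn_integral_cong) (auto simp: \<psi>_def monge_ampere_def space_measure_of_conv)
    then show ?thesis using nn_integral_monge_ampere[OF \<Omega> w \<psi>_m] by simp
  qed
  have "(\<integral>\<^sup>+ x. ennreal (\<phi> x) \<partial>monge_ampere \<Omega> u)
    = (\<integral>\<^sup>+ p. ennreal (\<psi> (grad U p)) * indicator \<Omega> (grad U p) \<partial>lborel)"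
    using MA[OF u] by (simp add: U_def)
  \<comment> \<open>On \<open>?P\<close> the restriction of \<open>grad U\<close> to
    \<open>\<Omega>\<close> is dropped, which can only enlarge the integrand; off \<open>?P\<close>
    the two gradients agree almost everywhere.\<close>
  also have "\<dots> \<le> (\<integral>\<^sup>+ p. ennreal (\<psi> (grad U p)) * indicator ?P p
      + ennreal (\<psi> (grad V p)) * indicator \<Omega> (grad V p) * indicator (- ?P) p \<partial>lborel)"
    using AE_off
  proof (intro nn_integral_mono_AE, eventually_elim)
    case (elim p)
    show ?case
    proof (cases "p \<in> ?P")
      case True
      then show ?thesis by (simp add: indicator_def)
    next
      case False
      then have "grad U p = grad V p" using elim UV[of p] by auto
      then show ?thesis using False by simp
    qed
  qed
  also have "\<dots> = (\<integral>\<^sup>+ p. ennreal (\<psi> (grad U p)) * indicator ?P p \<partial>lborel)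
      + (\<integral>\<^sup>+ p. ennreal (\<psi> (grad V p)) * indicator \<Omega> (grad V p) * indicator (- ?P) p \<partial>lborel)"
    by (rule nn_integral_add) measurable
  also have "\<dots> \<le> (\<integral>\<^sup>+ p. ennreal (\<psi> (grad V p)) * indicator ?P p \<partial>lborel)
      + (\<integral>\<^sup>+ p. ennreal (\<psi> (grad V p)) * indicator \<Omega> (grad V p) * indicator (- ?P) p \<partial>lborel)"
    unfolding U_def V_def
    by (intro add_right_mono nn_integral_grad_conjugate_on_mono[OF \<Omega> u v eq \<psi>_m \<psi>_C \<psi>_cont \<psi>_conc \<psi>_nonneg])
  also have "\<dots> = (\<integral>\<^sup>+ p. ennreal (\<psi> (grad V p)) * indicator ?P p
      + ennreal (\<psi> (grad V p)) * indicator \<Omega> (grad V p) * indicator (- ?P) p \<partial>lborel)"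
    by (rule nn_integral_add[symmetric]) measurable
  \<comment> \<open>For \<open>v\<close> the restriction costs nothing: almost everywhere on
    \<open>?P\<close> the gradient lies in \<open>\<Omega>\<close>, so the indicator can be restored
    with equality.\<close>
  also have "\<dots> = (\<integral>\<^sup>+ p. ennreal (\<psi> (grad V p)) * indicator \<Omega> (grad V p) \<partial>lborel)"
    using AE_on by (intro nn_integral_cong_AE) (auto elim!: eventually_mono simp: indicator_def)
  also have "\<dots> = (\<integral>\<^sup>+ x. ennreal (\<phi> x) \<partial>monge_ampere \<Omega> v)"
    using MA[OF v] by (simp add: V_def)
  finally show ?thesis .
qed

end
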